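(* Let $1\le s\le n\le N$ be integers, let $\mathbf{A}_1,\ldots,\mathbf{A}_N\in\mathbb{R}^{N\times N}$ be symmetric matrices, let $y_1,\ldots,y_N\in\mathbb{R}$, and let $S\subseteq\{1,\ldots,n\}$ with $|S|=s$. Let $\mathbf{B}_i=\mathbf{U}_S^T\mathbf{A}_i\mathbf{U}_S\in\mathbb{R}^{s\times s}$ and $$g(\mathbf{z})=\sum_{i=1}^N(\mathbf{z}^T\mathbf{B}_i\mathbf{z}-y_i)^2,\qquad \mathbf{z}\in\mathbb{R}^s,$$ and for $\mathbf{z}\in\mathbb{R}^s$ let $J(\mathbf{z})\in\mathbb{R}^{N\times s}$ be the matrix whose $i$th row is $2(\mathbf{B}_i\mathbf{z})^T$. Let $\{\mathbf{z}_k\}_{k\ge 0}$ be an infinite sequence generated by the damped Gauss-Newton (DGN) method (defined in the context) from an arbitrary starting point $\mathbf{z}_0\in\mathbb{R}^s$. Assume that $\sum_{i=1}^N\mathbf{B}_i\succ\mathbf{0}$ (positive definite) and that there exists $\underline{\lambda}>0$ such that for all $k\ge 0$ $$\lambda_{\min}\big(J(\mathbf{z}_k)^TJ(\mathbf{z}_k)\big)\ge\underline{\lambda}.$$ Then $\nabla g(\mathbf{z}_k)\to\mathbf{0}$ as $k\to\infty$, and there exists a constant $C>0$ (not depending on $k$) such that for all $k\ge 1$ $$\min_{p=1,\ldots,k}\|\nabla g(\mathbf{z}_p)\|\le\frac{\sqrt{g(\mathbf{z}_0)}}{C\sqrt{k+1}}.$$ Moreover, each limit point (accumulation point) of the sequence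 $\{\mathbf{z}_k\}$ is a stationary point of $g$, i.e. a point at which $\nabla g$ vanishes.
   Context: Notation: $\mathbf{U}_S\in\mathbb{R}^{N\times s}$ is the matrix consisting of the columns of the $N\times N$ identity matrix indexed by $S$; $\|\cdot\|$ is the Euclidean norm; $\lambda_{\min}$ denotes the smallest eigenvalue of a symmetric matrix. DGN method (for minimizing $g$ over $\mathbb{R}^s$). Start with an arbitrary $\mathbf{z}_0\in\mathbb{R}^s$ and $t_0=0.5$. For $k=1,2,\ldots$, given $\mathbf{z}_{k-1}$ and $t_{k-1}$: 1. Gauss-Newton direction: let $\mathbf{b}_k\in\mathbb{R}^N$ be the vector whose $i$th component is $y_i+\mathbf{z}_{k-1}^T\mathbf{B}_i\mathbf{z}_{k-1}$, let $\tilde{\mathbf{z}}_k=(J(\mathbf{z}_{k-1})^TJ(\mathbf{z}_{k-1}))^{-1}J(\mathbf{z}_{k-1})^T\mathbf{b}_k$ (the solution of the linear least-squares problem $\min_{\mathbf{z}}\|J(\mathbf{z}_{k-1})\mathbf{z}-\mathbf{b}_k\|^2$), and set $\mathbf{d}_k=\mathbf{z}_{k-1}-\tilde{\mathbf{z}}_k$. 2. Stepsize by backtracking: set $u=\min\{2t_{k-1},1\}$ and $t_k=(\tfrac12)^m u$, where $m$ is the minimal nonnegative integer for which $$g\big(\mathbf{z}_{k-1}-(\tfrac12)^m u\,\mathbf{d}_k\big)<g(\mathbf{z}_{k-1})-u(\tfrac12)^{m+1}\nabla g(\mathbf{z}_{k-1})^T\mathbf{d}_k.$$ 3. Update: $\mathbf{z}_k=\mathbf{z}_{k-1}-t_k\mathbf{d}_k$.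 The method is run without a stopping rule. That the sequence is infinite means that every step is well defined; in particular, an integer $m$ as in step 2 exists at every iteration. *)

theory Defs
  imports "HOL-Analysis.Analysis"
begin

text \<open>
  A finite linearly ordered index type is identified with \<open>{1, ..., CARD('a)}\<close> through its order:
  \<open>idx i\<close> is the 1-based position of \<open>i\<close>.
\<close>

definition idx :: "'a::{finite,linorder} \<Rightarrow> nat" where
  "idx i = card {..i}"

text \<open>
  Column \<open>q\<close> of \<open>U_sub S\<close> is the column of the identity matrix whose index is the
  \<open>idx q\<close>-th smallest element of \<open>S\<close>. This is meaningful only if \<open>card S = CARD('s)\<close>.
\<close>

definition U_sub :: "'N set \<Rightarrow> real^('s::{finite,linorder})^('N::{finite,linorder})" where
  "U_sub S = (\<chi> i q. mat 1 $ i $ (sorted_list_of_set S ! (idx q - 1)))"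

definition B_sub ::
  "('N \<Rightarrow> real^('N::{finite,linorder})^('N::{finite,linorder})) \<Rightarrow> 'N set \<Rightarrow> 'N
     \<Rightarrow> real^('s::{finite,linorder})^('s::{finite,linorder})" where
  "B_sub A S i = transpose (U_sub S) ** A i ** U_sub S"

definition g_obj :: "('N::finite \<Rightarrow> real^'s^'s) \<Rightarrow> real^'N \<Rightarrow> real^('s::finite) \<Rightarrow> real" where
  "g_obj B y z = (\<Sum>i\<in>UNIV. (z \<bullet> (B i *v z) - y $ i)\<^sup>2)"

definition J_mat :: "('N::finite \<Rightarrow> real^'s^'s) \<Rightarrow> real^('s::finite) \<Rightarrow> real^'s^'N" where
  "J_mat B z = (\<chi> i. 2 *\<^sub>R (B i *v z))"

text \<open>
  The gradient vector, unspecified where the function is not differentiable.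
\<close>

definition grad :: "('a::real_inner \<Rightarrow> real) \<Rightarrow> 'a \<Rightarrow> 'a" where
  "grad f x = (THE D. GDERIV f x :> D)"

lemma grad_eqI:
  assumes "GDERIV f x :> D"
  shows "grad f x = D"
  unfolding grad_def
proof (rule the_equality, rule assms)
  fix D' assume "GDERIV f x :> D'"
  then have "(\<lambda>h. h \<bullet> D') = (\<lambda>h. h \<bullet> D)"
    using assms has_derivative_unique unfolding gderiv_def by blast
  then show "D' = D"
    by (metis vector_eq_ldot)
qed

definition stationary_point :: "('a::real_inner \<Rightarrow> real) \<Rightarrow> 'a \<Rightarrow> bool" where
  "stationary_point f x \<longleftrightarrow> GDERIV f x :> 0"

definition pos_def :: "real^'s^('s::finite) \<Rightarrow> bool" where
  "pos_def M \<longleftrightarrow> transpose M = M \<and> (\<forall>x. x \<noteq> 0 \<longrightarrow> x \<bullet> (M *v x) > 0)"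

definition eigenvalues :: "real^'s^('s::finite) \<Rightarrow> real set" where
  "eigenvalues M = {l. \<exists>v. v \<noteq> 0 \<and> M *v v = l *\<^sub>R v}"

text \<open>
  Intended for symmetric \<open>M\<close>, where the set of real eigenvalues is finite and nonempty.
\<close>

definition lambda_min :: "real^'s^('s::finite) \<Rightarrow> real" where
  "lambda_min M = Min (eigenvalues M)"

definition gn_rhs :: "('N::finite \<Rightarrow> real^'s^'s) \<Rightarrow> real^'N \<Rightarrow> real^('s::finite) \<Rightarrow> real^'N" where
  "gn_rhs B y z = (\<chi> i. y $ i + z \<bullet> (B i *v z))"

definition gn_point :: "('N::finite \<Rightarrow> real^'s^'s) \<Rightarrow> real^'N \<Rightarrow> real^('s::finite) \<Rightarrow> real^'s" where
  "gn_point B y z =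
     matrix_inv (transpose (J_mat B z) ** J_mat B z) *v (transpose (J_mat B z) *v gn_rhs B y z)"

definition gn_dir :: "('N::finite \<Rightarrow> real^'s^'s) \<Rightarrow> real^'N \<Rightarrow> real^('s::finite) \<Rightarrow> real^'s" where
  "gn_dir B y z = z - gn_point B y z"

definition backtrack_ok ::
  "('N::finite \<Rightarrow> real^'s^'s) \<Rightarrow> real^'N \<Rightarrow> real^('s::finite) \<Rightarrow> real \<Rightarrow> nat \<Rightarrow> bool" where
  "backtrack_ok B y z u m \<longleftrightarrow>
     g_obj B y (z - ((1/2)^m * u) *\<^sub>R gn_dir B y z)
       < g_obj B y z - u * (1/2)^(m+1) * (grad (g_obj B y) z \<bullet> gn_dir B y z)"

text \<open>
  One iteration from \<open>(z, t)\<close> to \<open>(z', t')\<close>. It is a relation, so that it fails when the step is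
  not well defined: when the Gauss-Newton system is singular or no backtracking exponent exists.
\<close>

definition dgn_step ::
  "('N::finite \<Rightarrow> real^'s^'s) \<Rightarrow> real^'N \<Rightarrow> real^('s::finite) \<Rightarrow> real \<Rightarrow> real^'s \<Rightarrow> real \<Rightarrow> bool" where
  "dgn_step B y z t z' t' \<longleftrightarrow>
     invertible (transpose (J_mat B z) ** J_mat B z) \<and>
     (\<exists>u m. u = min (2 * t) 1 \<and>
            backtrack_ok B y z u m \<and> (\<forall>m'<m. \<not> backtrack_ok B y z u m') \<and>
            t' = (1/2)^m * u) \<and>
     z' = z - t' *\<^sub>R gn_dir B y z"

definition dgn_sequence ::
  "('N::finite \<Rightarrow> real^'s^'s) \<Rightarrow> real^'N \<Rightarrow> (nat \<Rightarrow> real^('s::finite)) \<Rightarrow> bool" where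
  "dgn_sequence B y z \<longleftrightarrow>
     (\<exists>t. t 0 = 1/2 \<and> (\<forall>k\<ge>1. dgn_step B y (z (k - 1)) (t (k - 1)) (z k) (t k)))"

end

theory Submission
  imports Defs
begin

text \<open>
  With the residual \<open>r\<close> and \<open>J = J(z)\<close>, the Gauss-Newton direction \<open>d\<close> solves \<open>J\<^sup>T J d = J\<^sup>T r\<close>, while
  \<open>\<nabla>g = 2 J\<^sup>T r\<close>; hence \<open>\<nabla>g \<bullet> d = 2 \<parallel>J d\<parallel>\<^sup>2\<close>, which is comparable with both \<open>\<parallel>d\<parallel>\<^sup>2\<close> and \<open>\<parallel>\<nabla>g\<parallel>\<^sup>2\<close>.
  Positive definiteness of \<open>\<Sum>\<^sub>i B\<^sub>i\<close> makes the sublevel sets of \<open>g\<close> bounded, so all constants can be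
  chosen uniformly along the sequence. As \<open>t \<mapsto> g (z - t d)\<close> is a quartic whose terms of order at least
  two are at most \<open>K t\<^sup>2 \<parallel>d\<parallel>\<^sup>2\<close> for \<open>t \<le> 1\<close>, backtracking never rejects a step below a fixed
  threshold, and the stepsizes stay bounded away from zero. Each iteration then
  decreases \<open>g\<close> by at least a fixed multiple of \<open>\<parallel>\<nabla>g\<parallel>\<^sup>2\<close>, and these decreases are summable.
\<close>

section \<open>Symmetric matrices\<close>

lemma inner_vector_matrix:
  fixes M :: "real^'n^'m"
  shows "x \<bullet> (v v* M) = (M *v x) \<bullet> v"
  by (metis dot_lmul_matrix inner_commute)

lemma inner_symmetric_matrix:
  fixes M :: "real^'s^'s"
  assumes "transpose M = M"
  shows "x \<bullet> (M *v v) = v \<bullet> (M *v x)"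
  by (metis assms inner_commute inner_vector_matrix transpose_matrix_vector)

text \<open>Compactness of the unit sphere gives the minimiser; homogeneity of degree two extends
  the bound to every \<open>x\<close>.\<close>

lemma rayleigh_quotient_attains_min:
  fixes M :: "real^'s^'s"
  obtains v where "norm v = 1" "\<And>x. (v \<bullet> (M *v v)) * (norm x)\<^sup>2 \<le> x \<bullet> (M *v x)"
proof -
  have cont: "continuous_on (sphere 0 1) (\<lambda>x::real^'s. x \<bullet> (M *v x))"
    by (intro continuous_intros linear_continuous_on) auto
  have "sphere 0 1 \<noteq> ({} :: (real^'s) set)"
    by simp
  then obtain v :: "real^'s" where v: "v \<in> sphere 0 1"
    and vmin: "\<And>x. x \<in> sphere 0 1 \<Longrightarrow> v \<bullet> (M *v v) \<le> x \<bullet> (M *v x)"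
    using continuous_attains_inf[OF compact_sphere _ cont] by blast
  have "(v \<bullet> (M *v v)) * (norm x)\<^sup>2 \<le> x \<bullet> (M *v x)" for x
  proof (cases "x = 0")
    case False
    let ?e = "(1 / norm x) *\<^sub>R x"
    have "v \<bullet> (M *v v) \<le> ?e \<bullet> (M *v ?e)"
      using False by (intro vmin) auto
    also have "\<dots> = (x \<bullet> (M *v x)) / (norm x)\<^sup>2"
      by (simp add: matrix_vector_mult_scaleR power2_eq_square)
    finally show ?thesis
      using False by (simp add: field_simps)
  qed simp
  then show thesis
    using v that by auto
qed

text \<open>Eigenvectors of distinct eigenvalues are orthogonal, hence independent. Finiteness is
  what gives the \<open>Min\<close> in \<open>lambda_min\<close> its order properties.\<close>

lemma finite_eigenvalues_symmetric:
  fixes M :: "real^'s^'s"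
  assumes sym: "transpose M = M"
  shows "finite (eigenvalues M)"
proof -
  define f where "f l = (SOME v. v \<noteq> 0 \<and> M *v v = l *\<^sub>R v)" for l
  have f: "f l \<noteq> 0 \<and> M *v f l = l *\<^sub>R f l" if "l \<in> eigenvalues M" for l
    unfolding f_def by (rule someI_ex) (use that in \<open>simp add: eigenvalues_def\<close>)
  have orth: "f k \<bullet> f l = 0" if "k \<in> eigenvalues M" "l \<in> eigenvalues M" "k \<noteq> l" for k l
    using inner_symmetric_matrix[OF sym, of "f k" "f l"] f that by (simp add: inner_commute)
  have "inj_on f (eigenvalues M)"
  proof (rule inj_onI, rule ccontr)
    fix k l assume "k \<in> eigenvalues M" "l \<in> eigenvalues M" "f k = f l" "k \<noteq> l"
    with orth[of k l] f[of k] show False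
      by simp
  qed
  moreover have "pairwise orthogonal (f ` eigenvalues M)"
    using orth by (auto simp: pairwise_def orthogonal_def)
  then have "finite (f ` eigenvalues M)"
    using f by (intro independent_imp_finite pairwise_orthogonal_independent) auto
  ultimately show ?thesis
    using finite_imageD by blast
qed

text \<open>The form \<open>x \<bullet> (M *v x) - \<mu> * (norm x)\<^sup>2\<close> is nonnegative
  and vanishes at \<open>v\<close>. If \<open>w = M *v v - \<mu> *\<^sub>R v\<close> were nonzero, a
  small move from \<open>v\<close> along \<open>- w\<close> would make it negative to first
  order.\<close>

lemma rayleigh_min_is_eigenvector:
  fixes M :: "real^'s^'s"
  assumes sym: "transpose M = M"
    and min: "\<And>x. \<mu> * (norm x)\<^sup>2 \<le> x \<bullet> (M *v x)" and eq: "v \<bullet> (M *v v) = \<mu> * (norm v)\<^sup>2"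
  shows "M *v v = \<mu> *\<^sub>R v"
proof (rule ccontr)
  assume neq: "M *v v \<noteq> \<mu> *\<^sub>R v"
  define w where "w = M *v v - \<mu> *\<^sub>R v"
  define b where "b = w \<bullet> (M *v w) - \<mu> * (norm w)\<^sup>2"
  define a where "a = (norm w)\<^sup>2"
  have a: "a > 0"
    using neq by (simp add: a_def w_def)
  have b: "b \<ge> 0"
    using min[of w] by (simp add: b_def)
  have expand: "0 \<le> - 2 * t * a + t\<^sup>2 * b" for t
  proof -
    have a_eq: "a = w \<bullet> (M *v v) - \<mu> * (w \<bullet> v)"
      unfolding a_def power2_norm_eq_inner by (subst (2) w_def) (simp add: inner_diff_right)
    have "(v - t *\<^sub>R w) \<bullet> (M *v (v - t *\<^sub>R w)) - \<mu> * (norm (v - t *\<^sub>R w))\<^sup>2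
        = (v \<bullet> (M *v v) - \<mu> * (norm v)\<^sup>2) - 2 * t * (w \<bullet> (M *v v) - \<mu> * (w \<bullet> v)) + t\<^sup>2 * b"
      using inner_symmetric_matrix[OF sym, of v w]
      unfolding b_def power2_norm_eq_inner
      by (simp add: matrix_vector_mult_diff_distrib matrix_vector_mult_scaleR
          inner_diff_left inner_diff_right inner_commute[of w v] power2_eq_square)
        (simp add: algebra_simps)
    then show ?thesis
      using min[of "v - t *\<^sub>R w"] eq a_eq by simp
  qed
  \<comment> \<open>The step length \<open>a / (b + 1)\<close> is close to the minimiser
    \<open>a / b\<close> of the quadratic but also makes sense for \<open>b = 0\<close>; it forces
    \<open>2 * a \<le> a\<close>.\<close>
  have "a / (b + 1) > 0"
    using a b by simp
  moreover have "(a / (b + 1)) * (2 * a) \<le> (a / (b + 1)) * ((a / (b + 1)) * b)"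
    using expand[of "a / (b + 1)"] by (simp add: power2_eq_square mult_ac)
  ultimately have "2 * a \<le> a / (b + 1) * b"
    using mult_le_cancel_left_pos by blast
  also have "\<dots> \<le> a"
    using a b by (simp add: field_simps)
  finally show False
    using a by simp
qed

text \<open>The least Rayleigh quotient is itself an eigenvalue, so the minimum over all eigenvalues
  cannot exceed it.\<close>

lemma lambda_min_le_rayleigh:
  fixes M :: "real^'s^'s"
  assumes sym: "transpose M = M"
  shows "lambda_min M * (norm x)\<^sup>2 \<le> x \<bullet> (M *v x)"
proof -
  obtain v where v: "norm v = 1" "\<And>x. (v \<bullet> (M *v v)) * (norm x)\<^sup>2 \<le> x \<bullet> (M *v x)"
    using rayleigh_quotient_attains_min by blast
  have "M *v v = (v \<bullet> (M *v v)) *\<^sub>R v"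
    using rayleigh_min_is_eigenvector[OF sym v(2)] v(1) by simp
  moreover have "v \<noteq> 0"
    using v(1) by auto
  ultimately have "v \<bullet> (M *v v) \<in> eigenvalues M"
    unfolding eigenvalues_def by blast
  then have "lambda_min M \<le> v \<bullet> (M *v v)"
    unfolding lambda_min_def by (simp add: finite_eigenvalues_symmetric[OF sym])
  then show ?thesis
    by (meson v(2) mult_right_mono order_trans zero_le_power2)
qed

lemma pos_def_coercive:
  assumes "pos_def M"
  obtains \<mu> where "\<mu> > 0" "\<And>x. \<mu> * (norm x)\<^sup>2 \<le> x \<bullet> (M *v x)"
proof -
  obtain v where v: "norm v = 1" "\<And>x. (v \<bullet> (M *v v)) * (norm x)\<^sup>2 \<le> x \<bullet> (M *v x)"
    using rayleigh_quotient_attains_min by blast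
  have "v \<noteq> 0"
    using v(1) by auto
  then have "v \<bullet> (M *v v) > 0"
    using assms unfolding pos_def_def by blast
  then show thesis
    using v(2) that by blast
qed

lemma matrix_inv_right:
  assumes "invertible M"
  shows "M ** matrix_inv M = mat 1"
  using assms unfolding invertible_def matrix_inv_def by (metis (mono_tags, lifting) someI_ex)

lemma transpose_B_sub:
  assumes "\<And>i. transpose (A i) = A i"
  shows "transpose (B_sub A S i) = B_sub A S i"
  by (simp add: B_sub_def matrix_transpose_mul assms matrix_mul_assoc)

section \<open>The residual map and its derivative\<close>

text \<open>The polarised form of the map
  \<open>z \<mapsto> (z \<bullet> (B i *v z))\<^sub>i\<close>. As one bounded bilinear map it
  inherits the product rule, continuity and a norm bound.\<close>

definition quad_forms :: "('N::finite \<Rightarrow> real^'s^'s) \<Rightarrow> real^'s \<Rightarrow> real^('s::finite) \<Rightarrow> real^'N" where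
  "quad_forms B x w = (\<chi> i. x \<bullet> (B i *v w))"

definition residual :: "('N::finite \<Rightarrow> real^'s^'s) \<Rightarrow> real^'N \<Rightarrow> real^('s::finite) \<Rightarrow> real^'N" where
  "residual B y z = quad_forms B z z - y"

lemma bounded_bilinear_quad_forms: "bounded_bilinear (quad_forms B)"
  unfolding bilinear_conv_bounded_bilinear[symmetric] bilinear_def
  by (auto intro!: linearI simp: quad_forms_def vec_eq_iff inner_add_left inner_add_right
      matrix_vector_right_distrib matrix_vector_mult_scaleR)

lemma g_obj_eq_norm: "g_obj B y z = (norm (residual B y z))\<^sup>2"
  unfolding power2_norm_eq_inner
  by (simp add: g_obj_def residual_def quad_forms_def inner_vec_def power2_eq_square)

lemma g_obj_nonneg: "0 \<le> g_obj B y z"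
  by (simp add: g_obj_eq_norm)

locale symmetric_forms =
  fixes B :: "'N::finite \<Rightarrow> real^'s^('s::finite)" and y :: "real^'N"
  assumes sym: "\<And>i. transpose (B i) = B i"
begin

interpretation Q: bounded_bilinear "quad_forms B"
  by (rule bounded_bilinear_quad_forms)

lemma quad_forms_commute: "quad_forms B x w = quad_forms B w x"
  by (simp add: quad_forms_def inner_symmetric_matrix[OF sym])

text \<open>By symmetry this is the derivative of \<open>quad_forms B z z\<close> in the direction
  \<open>w\<close>, so \<open>J_mat\<close> is the Jacobian of the residual.\<close>

lemma J_mat_mult: "J_mat B z *v w = 2 *\<^sub>R quad_forms B z w"
  by (subst quad_forms_commute)
    (simp add: J_mat_def quad_forms_def vec_eq_iff matrix_vector_mult_def inner_vec_def
      sum_distrib_left mult_ac)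

lemma GDERIV_g_obj:
  "GDERIV (g_obj B y) z :> 2 *\<^sub>R (transpose (J_mat B z) *v residual B y z)"
proof -
  have res: "(residual B y has_derivative (\<lambda>h. J_mat B z *v h)) (at z)"
    unfolding residual_def J_mat_mult
    by (rule derivative_eq_intros Q.FDERIV refl)+ (simp add: quad_forms_commute[of _ z] scaleR_2)
  have "((\<lambda>x. residual B y x \<bullet> residual B y x) has_derivative
      (\<lambda>h. residual B y z \<bullet> (J_mat B z *v h) + (J_mat B z *v h) \<bullet> residual B y z)) (at z)"
    using has_derivative_inner[OF res res] .
  then show ?thesis
    unfolding gderiv_def g_obj_eq_norm power2_norm_eq_inner
    by (simp add: inner_vector_matrix inner_commute[of "residual B y z"])
qed

lemma grad_g_obj: "grad (g_obj B y) z = 2 *\<^sub>R (transpose (J_mat B z) *v residual B y z)"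
  by (rule grad_eqI, rule GDERIV_g_obj)

lemma inner_grad_g_obj:
  "grad (g_obj B y) z \<bullet> w = 2 * (residual B y z \<bullet> (J_mat B z *v w))"
  by (simp add: grad_g_obj inner_commute[of _ w] inner_vector_matrix inner_commute[of "residual B y z"])

lemma continuous_grad_g_obj: "continuous_on UNIV (grad (g_obj B y))"
proof -
  \<comment> \<open>The 4 combines the factor 2 of the squared norm with the factor 2 in the rows of
    \<open>J_mat\<close>; in this form the continuity rules apply.\<close>
  have "grad (g_obj B y) = (\<lambda>z. \<Sum>i\<in>UNIV. (4 * residual B y z $ i) *\<^sub>R (B i *v z))"
    by (rule ext) (simp add: grad_g_obj vec_eq_iff matrix_vector_mult_def transpose_def J_mat_def
      sum_distrib_left mult_ac)
  moreover have "continuous_on UNIV (residual B y)"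
    unfolding residual_def by (intro continuous_intros Q.continuous_on)
  ultimately show ?thesis
    by (auto intro!: continuous_intros matrix_vector_mult_linear_continuous_on)
qed

section \<open>The Gauss-Newton direction and the gradient\<close>

text \<open>Since \<open>J_mat B z *v z\<close> is twice \<open>quad_forms B z z\<close>,
  subtracting \<open>gn_rhs\<close> leaves exactly the residual. Hence the direction solves the
  normal equations with the residual as right-hand side.\<close>

lemma gn_dir_normal_equation:
  assumes "invertible (transpose (J_mat B z) ** J_mat B z)"
  shows "transpose (J_mat B z) *v (J_mat B z *v gn_dir B y z) = transpose (J_mat B z) *v residual B y z"
proof -
  let ?J = "J_mat B z"
  let ?M = "transpose ?J ** ?J"
  have rhs: "?J *v z - gn_rhs B y z = residual B y z"
    by (simp add: J_mat_mult vec_eq_iff gn_rhs_def residual_def quad_forms_def)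
  have "?M *v gn_point B y z = transpose ?J *v gn_rhs B y z"
    unfolding gn_point_def by (subst matrix_vector_mul_assoc) (simp add: matrix_inv_right[OF assms])
  then have "?M *v gn_dir B y z = ?M *v z - transpose ?J *v gn_rhs B y z"
    by (simp only: gn_dir_def matrix_vector_mult_diff_distrib)
  also have "\<dots> = transpose ?J *v (?J *v z - gn_rhs B y z)"
    by (simp only: matrix_vector_mult_diff_distrib matrix_vector_mul_assoc)
  finally show ?thesis
    by (simp only: rhs matrix_vector_mul_assoc)
qed

lemma grad_eq_gn_dir:
  assumes "invertible (transpose (J_mat B z) ** J_mat B z)"
  shows "grad (g_obj B y) z = 2 *\<^sub>R (transpose (J_mat B z) *v (J_mat B z *v gn_dir B y z))"
  by (simp only: grad_g_obj gn_dir_normal_equation[OF assms])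

lemma inner_grad_gn_dir:
  assumes "invertible (transpose (J_mat B z) ** J_mat B z)"
  shows "grad (g_obj B y) z \<bullet> gn_dir B y z = 2 * (norm (J_mat B z *v gn_dir B y z))\<^sup>2"
  unfolding grad_eq_gn_dir[OF assms] power2_norm_eq_inner
  by (simp add: inner_commute[of _ "gn_dir B y z"] inner_vector_matrix)

section \<open>Uniform constants on bounded sublevel sets\<close>

text \<open>The form of \<open>\<Sum>i. B i\<close> at \<open>z\<close> is the sum of the components
  of residual plus \<open>y\<close>, which are bounded on a sublevel set; coercivity then bounds
  \<open>norm z\<close>.\<close>

lemma sublevel_bounded:
  assumes "pos_def (\<Sum>i\<in>UNIV. B i)"
  obtains R where "R > 0" "\<And>z. g_obj B y z \<le> G \<Longrightarrow> norm z \<le> R"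
proof -
  obtain \<mu> where \<mu>: "\<mu> > 0" "\<And>x. \<mu> * (norm x)\<^sup>2 \<le> x \<bullet> ((\<Sum>i\<in>UNIV. B i) *v x)"
    using pos_def_coercive[OF assms] by blast
  define T where "T = real CARD('N) * (sqrt \<bar>G\<bar> + norm y) / \<mu>"
  have T: "T \<ge> 0"
    using \<mu>(1) by (simp add: T_def)
  have "norm z \<le> sqrt T + 1" if "g_obj B y z \<le> G" for z
  proof -
    have mult_sum: "(\<Sum>i\<in>I. B i) *v z = (\<Sum>i\<in>I. B i *v z)" if "finite I" for I
      using that by induction (auto simp: matrix_vector_mult_add_rdistrib)
    have "norm (residual B y z) \<le> sqrt \<bar>G\<bar>"
      using that by (intro real_le_rsqrt) (simp add: g_obj_eq_norm)
    then have bound: "\<bar>residual B y z $ i\<bar> + \<bar>y $ i\<bar> \<le> sqrt \<bar>G\<bar> + norm y" for i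
      using component_le_norm_cart[of "residual B y z" i] component_le_norm_cart[of y i] by linarith
    have "z \<bullet> ((\<Sum>i\<in>UNIV. B i) *v z) = (\<Sum>i\<in>UNIV. residual B y z $ i + y $ i)"
      by (simp add: mult_sum inner_sum_right residual_def quad_forms_def)
    also have "\<dots> \<le> (\<Sum>i\<in>(UNIV::'N set). sqrt \<bar>G\<bar> + norm y)"
      by (rule sum_mono) (use bound in \<open>smt (verit)\<close>)
    finally have "\<mu> * (norm z)\<^sup>2 \<le> \<mu> * T"
      using \<mu>(2)[of z] \<mu>(1) by (simp add: T_def)
    then have "(norm z)\<^sup>2 \<le> T"
      using \<mu>(1) by simp
    then show ?thesis
      by (simp add: real_le_rsqrt add_increasing2)
  \<comment> \<open>The bound \<open>sqrt T + 1\<close> serves as the radius because the added 1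
    keeps it positive even when \<open>T = 0\<close>.\<close>
  qed
  then show thesis
    using that[of "sqrt T + 1"] T by (simp add: add_nonneg_pos)
qed

text \<open>Along a line the residual is quadratic in \<open>t\<close>, so \<open>g\<close> is an
  explicit quartic. Cauchy-Schwarz and \<open>t \<le> 1\<close> reduce the terms of order two to
  four to one multiple of \<open>t\<^sup>2\<close>.\<close>

lemma g_obj_step_le:
  assumes t: "0 \<le> t" "t \<le> 1"
  shows "g_obj B y (z - t *\<^sub>R d) \<le> g_obj B y z - t * (grad (g_obj B y) z \<bullet> d)
    + t\<^sup>2 * ((norm (J_mat B z *v d))\<^sup>2 + 2 * norm (residual B y z) * norm (quad_forms B d d)
      + 2 * norm (J_mat B z *v d) * norm (quad_forms B d d) + (norm (quad_forms B d d))\<^sup>2)"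
proof -
  define r where "r = residual B y z"
  define j where "j = J_mat B z *v d"
  define q where "q = quad_forms B d d"
  have res: "residual B y (z - t *\<^sub>R d) = r - t *\<^sub>R j + t\<^sup>2 *\<^sub>R q"
    by (simp add: r_def j_def q_def residual_def J_mat_mult Q.diff_left Q.diff_right
        Q.scaleR_left Q.scaleR_right quad_forms_commute[of d z] power2_eq_square
        scaleR_2 algebra_simps)
  have "g_obj B y (z - t *\<^sub>R d) = g_obj B y z - t * (grad (g_obj B y) z \<bullet> d)
      + t\<^sup>2 * ((norm j)\<^sup>2 + 2 * (r \<bullet> q) - 2 * t * (j \<bullet> q) + t\<^sup>2 * (norm q)\<^sup>2)"
    unfolding g_obj_eq_norm res inner_grad_g_obj
    unfolding r_def[symmetric] j_def[symmetric] power2_norm_eq_inner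
    by (simp add: algebra_simps inner_commute power2_eq_square)
  moreover have "r \<bullet> q \<le> norm r * norm q"
    by (rule norm_cauchy_schwarz)
  moreover have "- 2 * t * (j \<bullet> q) \<le> 2 * (norm j * norm q)"
  proof -
    have "- (t * (j \<bullet> q)) \<le> t * (norm j * norm q)"
      using t(1) Cauchy_Schwarz_ineq2[of j q] mult_left_mono[of "- (j \<bullet> q)" "norm j * norm q" t] by simp
    also have "\<dots> \<le> norm j * norm q"
      using t by (simp add: mult_left_le_one_le)
    finally show ?thesis by simp
  qed
  moreover have "t\<^sup>2 * (norm q)\<^sup>2 \<le> (norm q)\<^sup>2"
    using t by (simp add: mult_left_le_one_le power_le_one)
  ultimately show ?thesis
    unfolding r_def[symmetric] j_def[symmetric] q_def[symmetric]
    by (auto intro!: mult_left_mono)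
qed

text \<open>The constants are fixed before \<open>z\<close>, so a single pair serves all iterates:
  \<open>\<tau>\<close> is a stepsize below which the backtracking test always succeeds, and
  \<open>c\<close> compares the slope along the direction with the squared gradient norm.\<close>

lemma uniform_step_constants:
  assumes lam: "lam > 0" and R: "R > 0" and G: "G \<ge> 0"
  obtains \<tau> c where "\<tau> > 0" "c > 0"
    "\<And>z. norm z \<le> R \<Longrightarrow> g_obj B y z \<le> G \<Longrightarrow>
      invertible (transpose (J_mat B z) ** J_mat B z) \<Longrightarrow>
      (\<And>w. lam * (norm w)\<^sup>2 \<le> (norm (J_mat B z *v w))\<^sup>2) \<Longrightarrow>
      c * (norm (grad (g_obj B y) z))\<^sup>2 \<le> grad (g_obj B y) z \<bullet> gn_dir B y z \<and>
      (\<forall>t. 0 < t \<and> t \<le> 1 \<and> t < \<tau> \<and> gn_dir B y z \<noteq> 0 \<longrightarrow>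
        g_obj B y (z - t *\<^sub>R gn_dir B y z)
          < g_obj B y z - t / 2 * (grad (g_obj B y) z \<bullet> gn_dir B y z))"
proof -
  obtain \<beta> where \<beta>: "\<beta> > 0" "\<And>x w. norm (quad_forms B x w) \<le> norm x * norm w * \<beta>"
    using Q.pos_bounded by blast
  \<comment> \<open>\<open>L\<close> bounds the operator norm of the Jacobian on the ball of radius
    \<open>R\<close>, \<open>D\<close> bounds the direction, and \<open>K * (norm d)\<^sup>2\<close>
    bounds the bracket in \<open>g_obj_step_le\<close>.\<close>
  define L where "L = 2 * R * \<beta>"
  have L: "L > 0"
    using R \<beta> by (simp add: L_def)
  define D where "D = sqrt G / sqrt lam"
  define K where "K = L\<^sup>2 + 2 * sqrt G * \<beta> + 2 * L * D * \<beta> + D\<^sup>2 * \<beta>\<^sup>2"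
  have D: "D \<ge> 0"
    using G lam by (simp add: D_def)
  have "L\<^sup>2 > 0"
    using L by simp
  then have K: "K > 0"
    unfolding K_def using L D G \<beta>(1) by (intro add_pos_nonneg mult_nonneg_nonneg) auto
  show thesis
  \<comment> \<open>Below \<open>lam / K\<close> the second-order error is less than half of the
    linear decrease. The other constant comes from \<open>norm (grad g) \<le> 2 * L * norm j\<close>
    and slope \<open>2 * (norm j)\<^sup>2\<close>.\<close>
  proof (rule that[of "lam / K" "1 / (2 * L\<^sup>2)"])
    fix z :: "real^'s"
    assume z: "norm z \<le> R" "g_obj B y z \<le> G"
      and inv: "invertible (transpose (J_mat B z) ** J_mat B z)"
      and low: "\<And>w. lam * (norm w)\<^sup>2 \<le> (norm (J_mat B z *v w))\<^sup>2"
    define d where "d = gn_dir B y z"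
    define j where "j = J_mat B z *v d"
    define r where "r = residual B y z"
    have J_le: "norm (J_mat B z *v w) \<le> L * norm w" for w
    proof -
      have "norm (J_mat B z *v w) \<le> 2 * (norm z * norm w * \<beta>)"
        using \<beta>(2)[of z w] by (simp add: J_mat_mult)
      also have "\<dots> \<le> 2 * (R * norm w * \<beta>)"
        using z(1) \<beta>(1) by (intro mult_left_mono mult_right_mono) auto
      finally show ?thesis by (simp add: L_def mult_ac)
    qed
    have JT_le: "norm (transpose (J_mat B z) *v v) \<le> L * norm v" for v
    proof -
      let ?p = "transpose (J_mat B z) *v v"
      have "norm ?p * norm ?p = (J_mat B z *v ?p) \<bullet> v"
        using inner_vector_matrix[of ?p v "J_mat B z"]
        by (simp add: power2_norm_eq_inner[symmetric] power2_eq_square)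
      also have "\<dots> \<le> norm (J_mat B z *v ?p) * norm v"
        by (rule norm_cauchy_schwarz)
      also have "\<dots> \<le> L * norm ?p * norm v"
        by (intro mult_right_mono J_le) simp
      finally have "norm ?p * norm ?p \<le> norm ?p * (L * norm v)"
        by (simp add: mult_ac)
      then show ?thesis
        using L by (cases "norm ?p = 0") auto
    qed
    have gd: "grad (g_obj B y) z \<bullet> d = 2 * (norm j)\<^sup>2"
      unfolding d_def j_def by (rule inner_grad_gn_dir[OF inv])
    have gr: "norm (grad (g_obj B y) z) \<le> 2 * (L * norm j)"
      using JT_le[of j] unfolding grad_eq_gn_dir[OF inv] d_def[symmetric] j_def[symmetric] by simp
    have "(norm (grad (g_obj B y) z))\<^sup>2 \<le> 4 * L\<^sup>2 * (norm j)\<^sup>2"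
      using power_mono[OF gr, of 2] by (simp add: power_mult_distrib)
    then have c: "1 / (2 * L\<^sup>2) * (norm (grad (g_obj B y) z))\<^sup>2 \<le> grad (g_obj B y) z \<bullet> d"
      using L by (simp add: gd field_simps)
    have r_le: "norm r \<le> sqrt G"
      using z(2) by (intro real_le_rsqrt) (simp add: g_obj_eq_norm r_def)
    \<comment> \<open>Two expressions for the slope are compared: \<open>j\<close> is the orthogonal
      projection of \<open>r\<close> onto the range of the Jacobian, hence not longer than
      \<open>r\<close>.\<close>
    have "2 * (norm j)\<^sup>2 = 2 * (r \<bullet> j)"
      using gd unfolding inner_grad_g_obj j_def r_def by simp
    also have "\<dots> \<le> 2 * (norm r * norm j)"
      using norm_cauchy_schwarz[of r j] by simp
    finally have "norm j \<le> norm r"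
      by (cases "norm j = 0") (auto simp: power2_eq_square)
    then have j_le: "norm j \<le> sqrt G"
      using r_le by simp
    have "sqrt lam * norm d \<le> norm j"
      using low[of d] lam unfolding j_def
      by (metis abs_norm_cancel real_sqrt_abs real_sqrt_le_mono real_sqrt_mult)
    then have d_le: "norm d \<le> D"
      using j_le lam by (simp add: D_def field_simps)
    define q where "q = quad_forms B d d"
    have q_le: "norm q \<le> \<beta> * (norm d)\<^sup>2"
      using \<beta>(2)[of d d] by (simp add: q_def power2_eq_square mult_ac)
    have bound: "(norm j)\<^sup>2 + 2 * norm r * norm q + 2 * norm j * norm q + (norm q)\<^sup>2 \<le> K * (norm d)\<^sup>2"
    proof -
      have jd: "norm j \<le> L * norm d"
        unfolding j_def by (rule J_le)
      have jD: "norm j \<le> L * D"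
        using jd mult_left_mono[OF d_le, of L] L by linarith
      have "(norm j)\<^sup>2 \<le> L\<^sup>2 * (norm d)\<^sup>2"
        using power_mono[OF jd, of 2] by (simp add: power_mult_distrib)
      moreover have "norm r * norm q \<le> sqrt G * (\<beta> * (norm d)\<^sup>2)"
        using r_le q_le G by (intro mult_mono) auto
      moreover have "norm j * norm q \<le> (L * D) * (\<beta> * (norm d)\<^sup>2)"
        using jD q_le L D by (intro mult_mono) auto
      moreover have "(norm q)\<^sup>2 \<le> (D\<^sup>2 * \<beta>\<^sup>2) * (norm d)\<^sup>2"
      proof -
        \<comment> \<open>This term is quartic in \<open>d\<close>; two of the four factors are
          absorbed by \<open>D\<close>.\<close>
        have "(norm q)\<^sup>2 \<le> (\<beta> * (norm d)\<^sup>2)\<^sup>2"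
          using q_le by (intro power_mono) auto
        also have "\<dots> = \<beta>\<^sup>2 * (norm d)\<^sup>2 * (norm d)\<^sup>2"
          by (simp add: power2_eq_square mult_ac)
        also have "\<dots> \<le> \<beta>\<^sup>2 * D\<^sup>2 * (norm d)\<^sup>2"
          using d_le by (intro mult_right_mono mult_left_mono power_mono) auto
        finally show ?thesis by (simp add: mult_ac)
      qed
      ultimately show ?thesis
        unfolding K_def by (simp add: algebra_simps)
    qed
    have "g_obj B y (z - t *\<^sub>R d) < g_obj B y z - t / 2 * (grad (g_obj B y) z \<bullet> d)"
      if t: "0 < t" "t \<le> 1" "t < lam / K" and d: "d \<noteq> 0" for t
    proof -
      have "g_obj B y (z - t *\<^sub>R d) \<le> g_obj B y z - t * (grad (g_obj B y) z \<bullet> d)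
          + t\<^sup>2 * ((norm j)\<^sup>2 + 2 * norm r * norm q + 2 * norm j * norm q + (norm q)\<^sup>2)"
        using g_obj_step_le[of t z d] t by (simp add: j_def r_def q_def)
      also have "\<dots> \<le> g_obj B y z - t * (grad (g_obj B y) z \<bullet> d) + t\<^sup>2 * (K * (norm d)\<^sup>2)"
        using bound by (intro add_left_mono mult_left_mono) auto
      also have "t\<^sup>2 * (K * (norm d)\<^sup>2) < t * (norm j)\<^sup>2"
      proof -
        have "t * K * (norm d)\<^sup>2 < lam * (norm d)\<^sup>2"
          using t(3) K d by (intro mult_strict_right_mono) (auto simp: field_simps)
        also have "\<dots> \<le> (norm j)\<^sup>2"
          unfolding j_def by (rule low)
        finally have "t * (t * K * (norm d)\<^sup>2) < t * (norm j)\<^sup>2"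
          using t(1) by (rule mult_strict_left_mono)
        then show ?thesis
          by (simp add: power2_eq_square mult_ac)
      qed
      finally show ?thesis
        by (simp add: gd)
    qed
    with c show "1 / (2 * L\<^sup>2) * (norm (grad (g_obj B y) z))\<^sup>2 \<le> grad (g_obj B y) z \<bullet> gn_dir B y z \<and>
      (\<forall>t. 0 < t \<and> t \<le> 1 \<and> t < lam / K \<and> gn_dir B y z \<noteq> 0 \<longrightarrow>
        g_obj B y (z - t *\<^sub>R gn_dir B y z)
          < g_obj B y z - t / 2 * (grad (g_obj B y) z \<bullet> gn_dir B y z))"
      by (simp add: d_def)
  qed (use lam K L in auto)
qed

section \<open>Sufficient decrease along the iteration\<close>

text \<open>The bound \<open>min (1/2) (\<tau>/2)\<close> is inherited: either the first trial
  \<open>min (2 * t) 1\<close> is accepted, or the last rejected trial, twice the accepted one, was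
  at least \<open>\<tau>\<close>.\<close>

lemma dgn_step_stepsize:
  assumes step: "dgn_step B y z t z' t'" and t: "0 < t" "min (1/2) (\<tau>/2) \<le> t"
    and accept: "\<And>u. 0 < u \<Longrightarrow> u \<le> 1 \<Longrightarrow> u < \<tau> \<Longrightarrow> gn_dir B y z \<noteq> 0 \<Longrightarrow>
        g_obj B y (z - u *\<^sub>R gn_dir B y z)
          < g_obj B y z - u / 2 * (grad (g_obj B y) z \<bullet> gn_dir B y z)"
  shows "0 < t'" "min (1/2) (\<tau>/2) \<le> t'"
    "g_obj B y z' < g_obj B y z - t' / 2 * (grad (g_obj B y) z \<bullet> gn_dir B y z)"
proof -
  let ?d = "gn_dir B y z"
  let ?g = "g_obj B y"
  obtain m where ok: "backtrack_ok B y z (min (2 * t) 1) m"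
    and least: "\<forall>m'<m. \<not> backtrack_ok B y z (min (2 * t) 1) m'"
    and t': "t' = (1/2)^m * min (2 * t) 1" and z': "z' = z - t' *\<^sub>R ?d"
    using step unfolding dgn_step_def by blast
  have ok_iff: "backtrack_ok B y z u k \<longleftrightarrow>
      ?g (z - ((1/2)^k * u) *\<^sub>R ?d) < ?g z - ((1/2)^k * u) / 2 * (grad ?g z \<bullet> ?d)" for u k
    by (simp add: backtrack_ok_def mult_ac)
  show "0 < t'"
    using t(1) by (simp add: t')
  show dec: "?g z' < ?g z - t' / 2 * (grad ?g z \<bullet> ?d)"
    using ok unfolding ok_iff z' t' .
  \<comment> \<open>For a zero direction the strict test would read
    \<open>g z < g z\<close>.\<close>
  then have d: "?d \<noteq> 0"
    by (auto simp: z')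
  show "min (1/2) (\<tau>/2) \<le> t'"
  proof (cases m)
    case 0
    then show ?thesis
      using t by (auto simp: t' min_def)
  next
    case (Suc k)
    define u where "u = (1/2)^k * min (2 * t) 1"
    have u: "0 < u" "u \<le> 1"
      using t(1) by (auto simp: u_def intro!: mult_le_one power_le_one)
    have "\<not> backtrack_ok B y z (min (2 * t) 1) k"
      using least Suc by simp
    then have "\<not> u < \<tau>"
      using accept[OF u _ d] unfolding ok_iff u_def by blast
    moreover have "t' = u / 2"
      by (simp add: t' u_def Suc)
    ultimately show ?thesis
      by simp
  qed
qed

lemma dgn_sufficient_decrease:
  assumes dgn: "dgn_sequence B y z" and pd: "pos_def (\<Sum>i\<in>UNIV. B i)" and lam: "lam > 0"
    and low: "\<And>k. lambda_min (transpose (J_mat B (z k)) ** J_mat B (z k)) \<ge> lam"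
  obtains c where "c > 0"
    "\<And>k. g_obj B y (z (Suc k)) \<le> g_obj B y (z k) - c * (norm (grad (g_obj B y) (z k)))\<^sup>2"
proof -
  let ?g = "g_obj B y"
  obtain t where t0: "t 0 = 1/2"
    and steps: "\<And>k. dgn_step B y (z k) (t k) (z (Suc k)) (t (Suc k))"
    using dgn unfolding dgn_sequence_def by (metis One_nat_def diff_Suc_1 le_add1 plus_1_eq_Suc)
  have inv: "invertible (transpose (J_mat B (z k)) ** J_mat B (z k))" for k
    using steps[of k] unfolding dgn_step_def by blast
  have J_low: "lam * (norm w)\<^sup>2 \<le> (norm (J_mat B (z k) *v w))\<^sup>2" for k w
  proof -
    let ?J = "J_mat B (z k)"
    have "lam * (norm w)\<^sup>2 \<le> lambda_min (transpose ?J ** ?J) * (norm w)\<^sup>2"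
      using low[of k] by (rule mult_right_mono) simp
    also have "\<dots> \<le> w \<bullet> ((transpose ?J ** ?J) *v w)"
      by (rule lambda_min_le_rayleigh) (simp add: matrix_transpose_mul)
    also have "\<dots> = (norm (?J *v w))\<^sup>2"
      by (simp add: matrix_vector_mul_assoc[symmetric] inner_vector_matrix power2_norm_eq_inner)
    finally show ?thesis .
  qed
  obtain R where R: "R > 0" "\<And>x. ?g x \<le> ?g (z 0) \<Longrightarrow> norm x \<le> R"
    using sublevel_bounded[OF pd] by blast
  obtain \<tau> c where \<tau>: "\<tau> > 0" and c: "c > 0"
    and const: "\<And>x. norm x \<le> R \<Longrightarrow> ?g x \<le> ?g (z 0) \<Longrightarrow>
      invertible (transpose (J_mat B x) ** J_mat B x) \<Longrightarrow>
      (\<And>w. lam * (norm w)\<^sup>2 \<le> (norm (J_mat B x *v w))\<^sup>2) \<Longrightarrow>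
      c * (norm (grad ?g x))\<^sup>2 \<le> grad ?g x \<bullet> gn_dir B y x \<and>
      (\<forall>t. 0 < t \<and> t \<le> 1 \<and> t < \<tau> \<and> gn_dir B y x \<noteq> 0 \<longrightarrow>
        ?g (x - t *\<^sub>R gn_dir B y x) < ?g x - t / 2 * (grad ?g x \<bullet> gn_dir B y x))"
    using uniform_step_constants[OF lam R(1) g_obj_nonneg] by metis
  define \<sigma> where "\<sigma> = min (1/2) (\<tau>/2)"
  have \<sigma>: "\<sigma> > 0"
    using \<tau> by (simp add: \<sigma>_def)
  have dec: "0 < t (Suc k) \<and> \<sigma> \<le> t (Suc k) \<and>
      ?g (z (Suc k)) \<le> ?g (z k) - \<sigma> * c / 2 * (norm (grad ?g (z k)))\<^sup>2"
    if level: "?g (z k) \<le> ?g (z 0)" and tk: "0 < t k" "\<sigma> \<le> t k" for k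
  proof -
    note const' = const[OF R(2)[OF level] level inv J_low]
    have st: "0 < t (Suc k)" "\<sigma> \<le> t (Suc k)"
      "?g (z (Suc k)) < ?g (z k) - t (Suc k) / 2 * (grad ?g (z k) \<bullet> gn_dir B y (z k))"
      using dgn_step_stepsize[OF steps[of k], of \<tau>] tk const' unfolding \<sigma>_def by blast+
    have "\<sigma> * (c * (norm (grad ?g (z k)))\<^sup>2) \<le> t (Suc k) * (grad ?g (z k) \<bullet> gn_dir B y (z k))"
      using st \<sigma> const' c by (intro mult_mono) auto
    then show ?thesis
      using st by simp
  qed
  \<comment> \<open>Sublevel membership and the stepsize bound must be carried together: the
    constants hold only on the initial sublevel set, and staying in it follows from the decrease
    they yield.\<close>
  have invariant: "?g (z k) \<le> ?g (z 0) \<and> 0 < t k \<and> \<sigma> \<le> t k" for k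
  proof (induction k)
    case 0
    then show ?case by (simp add: t0 \<sigma>_def)
  next
    case (Suc k)
    have "0 \<le> \<sigma> * c / 2 * (norm (grad ?g (z k)))\<^sup>2"
      using \<sigma> c by simp
    then show ?case
      using Suc dec[of k] by linarith
  qed
  show thesis
  \<comment> \<open>The least stepsize, the slope constant and the factor 1/2 of the acceptance
    test.\<close>
  proof (rule that[of "\<sigma> * c / 2"])
    show "\<sigma> * c / 2 > 0"
      using \<sigma> c by simp
  qed (use dec invariant in blast)
qed

end

section \<open>From sufficient decrease to convergence and rate\<close>

text \<open>Telescoping bounds the sum of the squares of \<open>h\<close> by \<open>f 0 / c\<close>.
  Summability gives the limit, and the smallest of \<open>k\<close> terms is at most their
  mean.\<close>

lemma sufficient_decrease_rate:
  fixes f h :: "nat \<Rightarrow> real"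
  assumes c: "c > 0" and f: "\<And>k. 0 \<le> f k" and h: "\<And>k. 0 \<le> h k"
    and dec: "\<And>k. f (Suc k) \<le> f k - c * (h k)\<^sup>2"
  shows "h \<longlonglongrightarrow> 0"
    and "k \<ge> 1 \<Longrightarrow> (MIN p\<in>{1..k}. h p) \<le> sqrt (f 0) / (sqrt (c / 2) * sqrt (real (k + 1)))"
proof -
  have total: "c * (\<Sum>p<k. (h p)\<^sup>2) \<le> f 0 - f k" for k
  proof (induction k)
    case (Suc k)
    then show ?case
      using dec[of k] by (simp add: algebra_simps)
  qed simp
  have partial: "(\<Sum>p<k. (h p)\<^sup>2) \<le> f 0 / c" for k
    using total[of k] f[of k] c by (simp add: field_simps)
  have "summable (\<lambda>p. (h p)\<^sup>2)"
    using partial by (intro summableI_nonneg_bounded) auto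
  then have "(\<lambda>p. sqrt ((h p)\<^sup>2)) \<longlonglongrightarrow> sqrt 0"
    by (intro tendsto_real_sqrt summable_LIMSEQ_zero)
  then show "h \<longlonglongrightarrow> 0"
    using h by simp
  show "(MIN p\<in>{1..k}. h p) \<le> sqrt (f 0) / (sqrt (c / 2) * sqrt (real (k + 1)))" if k: "k \<ge> 1"
  proof -
    define \<eta> where "\<eta> = (MIN p\<in>{1..k}. h p)"
    have \<eta>: "\<eta> \<le> h p" if "p \<in> {1..k}" for p
      unfolding \<eta>_def using that by (intro Min_le) auto
    have "\<eta> \<in> h ` {1..k}"
      unfolding \<eta>_def using k by (intro Min_in) auto
    then have \<eta>0: "\<eta> \<ge> 0"
      using h by auto
    have "real k * \<eta>\<^sup>2 = (\<Sum>p\<in>{1..k}. \<eta>\<^sup>2)"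
      by simp
    also have "\<dots> \<le> (\<Sum>p\<in>{1..k}. (h p)\<^sup>2)"
      using \<eta> \<eta>0 by (intro sum_mono power_mono) auto
    \<comment> \<open>The telescoped sum starts at index 0, the minimum at 1; the extra term is
      nonnegative.\<close>
    also have "\<dots> \<le> (\<Sum>p<Suc k. (h p)\<^sup>2)"
      by (intro sum_mono2) auto
    also have "\<dots> \<le> f 0 / c"
      by (rule partial)
    finally have sum_le: "real k * \<eta>\<^sup>2 \<le> f 0 / c" .
    \<comment> \<open>Only \<open>k\<close> terms are available, but
      \<open>k + 1 \<le> 2 * k\<close> for \<open>k \<ge> 1\<close>; this costs the factor 2 in
      \<open>c / 2\<close>.\<close>
    have "real (k + 1) * \<eta>\<^sup>2 \<le> (2 * real k) * \<eta>\<^sup>2"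
      using k by (intro mult_right_mono) auto
    then have "real (k + 1) * \<eta>\<^sup>2 \<le> 2 * (f 0 / c)"
      using sum_le by linarith
    then have "c / 2 * real (k + 1) * \<eta>\<^sup>2 \<le> f 0"
      using c by (simp add: field_simps)
    then have "sqrt (c / 2 * real (k + 1) * \<eta>\<^sup>2) \<le> sqrt (f 0)"
      by (rule real_sqrt_le_mono)
    then have "sqrt (c / 2) * sqrt (real (k + 1)) * \<eta> \<le> sqrt (f 0)"
      using \<eta>0 by (simp add: real_sqrt_mult real_sqrt_divide)
    moreover have "sqrt (c / 2) * sqrt (real (k + 1)) > 0"
      using c by simp
    ultimately have "\<eta> \<le> sqrt (f 0) / (sqrt (c / 2) * sqrt (real (k + 1)))"
      by (simp only: pos_le_divide_eq mult.commute)
    then show ?thesis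
      by (simp only: \<eta>_def)
  qed
qed

theorem theorem1:
  fixes n :: nat
    and A :: "'N \<Rightarrow> real^('N::{finite,linorder})^('N::{finite,linorder})"
    and y :: "real^('N::{finite,linorder})"
    and S :: "'N set"
    and B :: "'N \<Rightarrow> real^('s::{finite,linorder})^('s::{finite,linorder})"
    and z :: "nat \<Rightarrow> real^('s::{finite,linorder})"
    and lam :: real
  assumes dims: "1 \<le> CARD('s)" "CARD('s) \<le> n" "n \<le> CARD('N)"
    and symA: "\<And>i. transpose (A i) = A i"
    and S: "S \<subseteq> {i. idx i \<le> n}" "card S = CARD('s)"
    and B: "B = B_sub A S"
    and dgn: "dgn_sequence B y z"
    and pd: "pos_def (\<Sum>i\<in>UNIV. B i)"
    and lam: "lam > 0" "\<And>k. lambda_min (transpose (J_mat B (z k)) ** J_mat B (z k)) \<ge> lam"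
  shows "(\<lambda>k. grad (g_obj B y) (z k)) \<longlonglongrightarrow> 0 \<and>
         (\<exists>C>0. \<forall>k\<ge>1. (MIN p\<in>{1..k}. norm (grad (g_obj B y) (z p)))
                        \<le> sqrt (g_obj B y (z 0)) / (C * sqrt (real (k + 1)))) \<and>
         (\<forall>x r. strict_mono (r :: nat \<Rightarrow> nat) \<and> (z \<circ> r) \<longlonglongrightarrow> x \<longrightarrow> stationary_point (g_obj B y) x)"
proof -
  let ?g = "g_obj B y"
  interpret symmetric_forms B y
    by unfold_locales (simp add: B transpose_B_sub[OF symA])
  obtain c where c: "c > 0"
    and dec: "\<And>k. ?g (z (Suc k)) \<le> ?g (z k) - c * (norm (grad ?g (z k)))\<^sup>2"
    using dgn_sufficient_decrease[OF dgn pd lam] by blast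
  note rate = sufficient_decrease_rate[of c "\<lambda>k. ?g (z k)" "\<lambda>k. norm (grad ?g (z k))",
      OF c g_obj_nonneg norm_ge_zero dec]
  have lim: "(\<lambda>k. grad ?g (z k)) \<longlonglongrightarrow> 0"
    using rate(1) by (rule tendsto_norm_zero_cancel)
  have "stationary_point ?g x" if r: "strict_mono r" and x: "(z \<circ> r) \<longlonglongrightarrow> x" for x r
  proof -
    have "isCont (grad ?g) x"
      using continuous_grad_g_obj by (simp add: continuous_on_eq_continuous_at)
    then have "(\<lambda>k. grad ?g ((z \<circ> r) k)) \<longlonglongrightarrow> grad ?g x"
      using x by (rule isCont_tendsto_compose)
    moreover have "(\<lambda>k. grad ?g ((z \<circ> r) k)) \<longlonglongrightarrow> 0"
      using LIMSEQ_subseq_LIMSEQ[OF lim r] by (simp add: o_def)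
    ultimately have "grad ?g x = 0"
      by (rule LIMSEQ_unique)
    \<comment> \<open>\<open>grad\<close> is a definite description, so its vanishing yields
      stationarity only together with the differentiability from
      \<open>GDERIV_g_obj\<close>.\<close>
    then show ?thesis
      using GDERIV_g_obj[of x] by (simp add: stationary_point_def grad_g_obj)
  qed
  moreover have "\<exists>C>0. \<forall>k\<ge>1. (MIN p\<in>{1..k}. norm (grad ?g (z p)))
      \<le> sqrt (?g (z 0)) / (C * sqrt (real (k + 1)))"
    using rate(2) c by (intro exI[of _ "sqrt (c / 2)"]) auto
  ultimately show ?thesis
    using lim by blast
qed

end
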